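(* Let $f:\mathbb{C}\to\mathbb{C}$ be a non-constant holomorphic function, and let $K$ be the Gaussian curvature of the complete Kähler metric on $\mathbb{C}\setminus\{f=0\}$ given by $$\phi(z)=\Big(|f'(z)|^2\big(1+|f(z)|^2u^2(|f(z)|^2)\big)+1\Big)|dz|^2,$$ where $u:(0,\infty)\to\mathbb{R}$, $u(t)=\dfrac{t-1}{t\log t}$ (with $u(1)=1$). Let $p\in\mathbb{C}$. (i) If $p\in\mathbb{C}\setminus\{f=0\}$, then $K(p)\le0$. In addition, if $f'(p)=0$, then $K(p)=0$ if and only if $f''(p)=0$. (ii) If $p\in\{f=0\}$, then $\lim_{z\to p}K(z)=-4$.
   Context: The metric is $\phi=f^*(g)+|dz|^2$, where $g=\big(1+|w|^2u^2(|w|^2)\big)|dw|^2$ is the Grauert metric on $\mathbb{C}^*$. The function $u$ is real analytic on $(0,\infty)$, the singularity at $t=1$ being removable with $u(1)=1$. The Gaussian curvature of a conformal metric $h(z)|dz|^2$ ($h>0$ smooth) is $-2h^{-3}\big(h\,\partial\bar\partial h-\partial h\,\bar\partial h\big)$, with $\partial=\partial/\partial z$, $\bar\partial=\partial/\partial\bar z$. *)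

theory Defs
  imports "HOL-Complex_Analysis.Complex_Analysis"
begin

definition wirtinger :: "(complex \<Rightarrow> complex) \<Rightarrow> complex \<Rightarrow> complex" where
  "wirtinger F z =
     (frechet_derivative F (at z) 1 - \<i> * frechet_derivative F (at z) \<i>) / 2"

definition wirtinger_bar :: "(complex \<Rightarrow> complex) \<Rightarrow> complex \<Rightarrow> complex" where
  "wirtinger_bar F z =
     (frechet_derivative F (at z) 1 + \<i> * frechet_derivative F (at z) \<i>) / 2"

lemma wirtinger_holomorphic:
  assumes "F field_differentiable at z"
  shows "wirtinger F z = deriv F z" and "wirtinger_bar F z = 0"
proof -
  have "(F has_derivative (*) (deriv F z)) (at z)"
    using assms by (simp add: DERIV_deriv_iff_field_differentiable flip: has_field_derivative_def)
  then have *: "frechet_derivative F (at z) = (*) (deriv F z)"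
    by (rule frechet_derivative_at [symmetric])
  show "wirtinger F z = deriv F z" "wirtinger_bar F z = 0"
    by (simp_all add: wirtinger_def wirtinger_bar_def * algebra_simps)
qed

text \<open>
  Gaussian curvature at \<open>z\<close> of the conformal metric \<open>h |dz|\<^sup>2\<close>, for \<open>h\<close> positive and smooth
  near \<open>z\<close>.  The Wirtinger operators act on complex-valued functions, so the value has type
  \<^typ>\<open>complex\<close>; it is a real number for such \<open>h\<close>, but no real part is taken here.
\<close>

definition gaussian_curvature :: "(complex \<Rightarrow> real) \<Rightarrow> complex \<Rightarrow> complex" where
  "gaussian_curvature h z =
     (let H = (\<lambda>w. complex_of_real (h w)) in
        - 2 / H z ^ 3 *
          (H z * wirtinger (wirtinger_bar H) z - wirtinger H z * wirtinger_bar H z))"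

text \<open>Only the values for \<open>t > 0\<close> are meaningful.\<close>

definition grauert_u :: "real \<Rightarrow> real" where
  "grauert_u t = (if t = 1 then 1 else (t - 1) / (t * ln t))"

text \<open>
  Density with respect to \<open>|dz|\<^sup>2\<close> of \<open>f\<^sup>*g + |dz|\<^sup>2\<close>, where
  \<open>g = (1 + |w|\<^sup>2 u\<^sup>2(|w|\<^sup>2)) |dw|\<^sup>2\<close> is the Grauert metric on the punctured plane.  It is a metric only
  off the zeros of \<open>f\<close>.
\<close>

definition phi_density :: "(complex \<Rightarrow> complex) \<Rightarrow> complex \<Rightarrow> real" where
  "phi_density f z =
     (cmod (deriv f z))\<^sup>2 * (1 + (cmod (f z))\<^sup>2 * (grauert_u ((cmod (f z))\<^sup>2))\<^sup>2) + 1"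

end

theory Submission
  imports Defs "HOL-Real_Asymp.Real_Asymp"
begin

text \<open>
  In the coordinate \<open>x = ln |w|\<close> the Grauert density is \<open>S x = 1 + (sinh x / x)\<^sup>2\<close>, and \<open>ln |f|\<close> is
  harmonic off the zeros of \<open>f\<close>.  With \<open>h = |f'|\<^sup>2 S + 1\<close>, \<open>a = f''\<close> and \<open>b = f'\<^sup>2 / (2 f)\<close>, the numerator
  of the curvature, up to the factor \<open>-2\<close>, is
  \<open>|f'|\<^sup>2 |b|\<^sup>2 (S S'' - S'\<^sup>2) + |a|\<^sup>2 S + 2 Re (a \<cdot> cnj b) S' + |b|\<^sup>2 S''\<close>.
  It is nonnegative because \<open>S\<close> is log-convex, which comes down to \<open>x\<^sup>2 \<le> sinh\<^sup>2 x\<close>.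

  Near a zero of \<open>f\<close> put \<open>q = f / f'\<close> and \<open>c = f f'' / f'\<^sup>2 = 1 - q'\<close>; both extend holomorphically over the
  zero, and \<open>q\<close> vanishes there to first order.  After division by \<open>h\<^sup>3\<close> everything except the term
  with \<open>S S'' - S'\<^sup>2\<close> carries a factor \<open>|q| x\<^sup>2 \<longrightarrow> 0\<close>, and that term tends to \<open>2\<close> by the asymptotics of
  \<open>S\<close> at \<open>- \<infinity>\<close>.
\<close>

section \<open>Wirtinger calculus\<close>

text \<open>One Frechet derivative carries differentiability and both Wirtinger derivatives, so the
  usual rules propagate \<open>a\<close> and \<open>b\<close> together.\<close>

definition has_wirtinger :: "(complex \<Rightarrow> complex) \<Rightarrow> complex \<Rightarrow> complex \<Rightarrow> complex \<Rightarrow> bool" where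
  "has_wirtinger F a b z \<longleftrightarrow> (F has_derivative (\<lambda>h. a * h + b * cnj h)) (at z)"

lemma has_wirtinger_imp:
  assumes "has_wirtinger F a b z"
  shows "wirtinger F z = a" "wirtinger_bar F z = b"
proof -
  have *: "frechet_derivative F (at z) = (\<lambda>h. a * h + b * cnj h)"
    using assms unfolding has_wirtinger_def by (rule frechet_derivative_at [symmetric])
  show "wirtinger F z = a" "wirtinger_bar F z = b"
    by (simp_all add: wirtinger_def wirtinger_bar_def * algebra_simps)
qed

lemma has_wirtinger_add:
  assumes "has_wirtinger F a b z" "has_wirtinger G c d z"
  shows "has_wirtinger (\<lambda>w. F w + G w) (a + c) (b + d) z"
  using has_derivative_add [OF assms [unfolded has_wirtinger_def]]
  by (simp add: has_wirtinger_def algebra_simps)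

lemma has_wirtinger_mult:
  assumes "has_wirtinger F a b z" "has_wirtinger G c d z"
  shows "has_wirtinger (\<lambda>w. F w * G w) (F z * c + a * G z) (F z * d + b * G z) z"
  using has_derivative_mult [OF assms [unfolded has_wirtinger_def]]
  by (simp add: has_wirtinger_def algebra_simps)

lemma has_wirtinger_const: "has_wirtinger (\<lambda>w. c) 0 0 z"
  by (simp add: has_wirtinger_def)

lemma has_wirtinger_holomorphic:
  assumes "(F has_field_derivative d) (at z)"
  shows "has_wirtinger F d 0 z"
  using assms by (simp add: has_wirtinger_def has_field_derivative_def)

lemma has_wirtinger_cnj:
  assumes "has_wirtinger F a b z"
  shows "has_wirtinger (\<lambda>w. cnj (F w)) (cnj b) (cnj a) z"
  using bounded_linear.has_derivative [OF bounded_linear_cnj assms [unfolded has_wirtinger_def]]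
  by (simp add: has_wirtinger_def algebra_simps)

lemma has_wirtinger_transform:
  assumes "has_wirtinger F a b z" "open U" "z \<in> U" "\<And>w. w \<in> U \<Longrightarrow> F w = G w"
  shows "has_wirtinger G a b z"
  using assms unfolding has_wirtinger_def by (blast intro: has_derivative_transform_within_open)

text \<open>Locally ln |f| is the real part of a holomorphic logarithm, so its differential is h
  \<mapsto> Re (d h / f z). The two coefficients are therefore d / (2 f z) and its conjugate, and
  the chain rule scales both by the real number \<open>s\<close>.\<close>

lemma has_wirtinger_ln_norm:
  assumes S: "(S has_real_derivative s) (at (ln (norm (f z))))"
    and f: "(f has_field_derivative d) (at z)" and nz: "f z \<noteq> 0"
  shows "has_wirtinger (\<lambda>w. of_real (S (ln (norm (f w)))))
           (of_real s * (d / (2 * f z))) (of_real s * cnj (d / (2 * f z))) z"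
proof -
  have "((\<lambda>w. norm (f w)) has_derivative (\<lambda>h. (d * h) \<bullet> sgn (f z))) (at z)"
    using has_derivative_compose [OF f [unfolded has_field_derivative_def] has_derivative_norm [OF nz]]
    by simp
  then have "((\<lambda>w. ln (norm (f w))) has_derivative
      (\<lambda>h. (d * h) \<bullet> sgn (f z) * inverse (norm (f z)))) (at z)"
    using nz by (auto intro!: derivative_eq_intros simp: field_simps)
  from has_derivative_compose [OF this S [unfolded has_field_derivative_def]]
  have "((\<lambda>w. of_real (S (ln (norm (f w)))) :: complex) has_derivative
      (\<lambda>h. of_real (s * ((d * h) \<bullet> sgn (f z) * inverse (norm (f z)))))) (at z)"
    by (rule has_derivative_of_real)
  moreover have "of_real (s * ((d * h) \<bullet> sgn (f z) * inverse (norm (f z)))) =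
      of_real s * (d / (2 * f z)) * h + of_real s * cnj (d / (2 * f z)) * cnj h" for h
  proof -
    have "(d * h) \<bullet> sgn (f z) * inverse (norm (f z)) = Re (d * h / f z)"
      by (simp add: complex_div_cnj [of "d * h" "f z"] Re_divide_of_real sgn_div_norm inner_complex_def
          power2_eq_square field_simps add_divide_distrib diff_divide_distrib flip: of_real_power)
    moreover have "complex_of_real (Re (d * h / f z)) = d / (2 * f z) * h + cnj (d / (2 * f z)) * cnj h"
    proof -
      have "complex_of_real (Re w) = (w + cnj w) / 2" for w by (simp add: complex_add_cnj)
      then show ?thesis by (simp add: add_divide_distrib mult.commute)
    qed
    ultimately show ?thesis by (simp add: algebra_simps)
  qed
  ultimately show ?thesis by (simp add: has_wirtinger_def)
qed

section \<open>The function sinh x / x and its log-convexity\<close>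

text \<open>
  Derivatives of \<open>sinh x / x\<close> on the real line are obtained from its entire extension, so that
  smoothness at the removable singularity \<open>x = 0\<close> comes for free.
\<close>

definition csinhc :: "complex \<Rightarrow> complex" where
  "csinhc z = (if z = 0 then 1 else sinh z / z)"

text \<open>\<open>csinhc\<close> and its derivatives are real on the real axis, so
  \<open>Re\<close> only changes the type.\<close>

definition sinhc :: "nat \<Rightarrow> real \<Rightarrow> real" where
  "sinhc n x = Re ((deriv ^^ n) csinhc (of_real x))"

lemma csinhc_holomorphic: "csinhc holomorphic_on UNIV"
proof -
  have "(sinh :: complex \<Rightarrow> complex) holomorphic_on UNIV"
    unfolding sinh_def by (intro holomorphic_intros)
  \<comment> \<open>\<open>csinhc\<close> is the difference quotient of \<open>sinh\<close> at 0,
    with the derivative filled in at 0.\<close>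
  then have "(\<lambda>z. if z = 0 then deriv sinh 0 else (sinh z - sinh 0) / (z - 0)) holomorphic_on (UNIV :: complex set)"
    by (rule pole_lemma_open) simp
  moreover have "deriv sinh (0::complex) = 1"
    by (rule DERIV_imp_deriv) (auto intro!: derivative_eq_intros)
  ultimately show ?thesis by (simp add: csinhc_def [abs_def] cong: if_cong)
qed

lemma deriv_csinhc_holomorphic: "(deriv ^^ n) csinhc holomorphic_on UNIV"
  by (rule holomorphic_higher_deriv [OF csinhc_holomorphic]) simp

lemma DERIV_sinhc: "(sinhc n has_real_derivative sinhc (Suc n) x) (at x)"
proof -
  have "((deriv ^^ n) csinhc has_field_derivative (deriv ^^ Suc n) csinhc (of_real x)) (at (of_real x))"
    using deriv_csinhc_holomorphic [of n] by (simp add: holomorphic_derivI)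
  from has_field_derivative_Re [OF has_vector_derivative_real_field [OF this]]
  show ?thesis by (simp add: sinhc_def [abs_def] o_def)
qed

lemma isCont_sinhc: "isCont (sinhc n) x"
  using DERIV_sinhc DERIV_isCont by blast

lemma sinhc_0: "x \<noteq> 0 \<Longrightarrow> sinhc 0 x = sinh x / x"
  by (simp add: sinhc_def csinhc_def sinh_field_def exp_of_real
      flip: of_real_minus of_real_diff of_real_divide)

lemma sinhc_0_0 [simp]: "sinhc 0 0 = 1"
  by (simp add: sinhc_def csinhc_def)

lemma sinhc_1:
  assumes "x \<noteq> 0" shows "sinhc (Suc 0) x = cosh x / x - sinh x / x\<^sup>2"
proof (rule DERIV_unique)
  have "((\<lambda>x. sinh x / x) has_real_derivative cosh x / x - sinh x / x\<^sup>2) (at x)"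
    using assms by (auto intro!: derivative_eq_intros simp: field_simps power2_eq_square)
  then show "(sinhc 0 has_real_derivative cosh x / x - sinh x / x\<^sup>2) (at x)"
    by (rule has_field_derivative_transform_within_open [where S = "-{0}"]) (use assms in \<open>auto simp: sinhc_0\<close>)
qed (rule DERIV_sinhc)

lemma sinhc_2:
  assumes "x \<noteq> 0" shows "sinhc (Suc (Suc 0)) x = sinh x / x - 2 * cosh x / x\<^sup>2 + 2 * sinh x / x ^ 3"
proof (rule DERIV_unique)
  have "((\<lambda>x. cosh x / x - sinh x / x\<^sup>2) has_real_derivative sinh x / x - 2 * cosh x / x\<^sup>2 + 2 * sinh x / x ^ 3) (at x)"
    using assms by (auto intro!: derivative_eq_intros simp: field_simps eval_nat_numeral)
  then show "(sinhc (Suc 0) has_real_derivative sinh x / x - 2 * cosh x / x\<^sup>2 + 2 * sinh x / x ^ 3) (at x)"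
    by (rule has_field_derivative_transform_within_open [where S = "-{0}"]) (use assms in \<open>auto simp: sinhc_1\<close>)
qed (rule DERIV_sinhc)

text \<open>For r = sinh x / x, (ln r)'' = 1 / x^2 - 1 / (sinh x)^2; multiplying by r^2 gives the
  right-hand side.\<close>

lemma sinhc_log_convex_eq:
  assumes "x \<noteq> 0"
  shows "sinhc 0 x * sinhc (Suc (Suc 0)) x - (sinhc (Suc 0) x)\<^sup>2 = ((sinh x)\<^sup>2 - x\<^sup>2) / x ^ 4"
proof -
  have "(cosh x)\<^sup>2 = (sinh x)\<^sup>2 + 1" by (simp add: cosh_square_eq)
  then have c: "cosh x * cosh x = sinh x * sinh x + 1" by (simp add: power2_eq_square)
  show ?thesis
    using assms by (simp add: sinhc_0 sinhc_1 sinhc_2 field_simps eval_nat_numeral c)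
qed

lemma abs_le_abs_sinh: "\<bar>x::real\<bar> \<le> \<bar>sinh x\<bar>"
proof -
  have *: "x \<le> sinh x" if "x \<ge> 0" for x :: real
  proof -
    have "sinh 0 - 0 \<le> sinh x - x"
      by (rule DERIV_nonneg_imp_nondecreasing [OF that])
         (auto intro!: exI derivative_eq_intros simp: cosh_real_ge_1)
    then show ?thesis by simp
  qed
  show ?thesis using * [of x] * [of "-x"] by (cases "x \<ge> 0") auto
qed

lemma sinhc_log_convex: "(sinhc (Suc 0) x)\<^sup>2 \<le> sinhc 0 x * sinhc (Suc (Suc 0)) x"
proof -
  let ?g = "\<lambda>x. sinhc 0 x * sinhc (Suc (Suc 0)) x - (sinhc (Suc 0) x)\<^sup>2"
  have *: "?g x \<ge> 0" if "x \<noteq> 0" for x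
    using abs_le_abs_sinh [of x] that by (simp add: sinhc_log_convex_eq abs_le_square_iff)
  \<comment> \<open>Continuity carries the inequality over to x = 0, where the closed forms break
    down.\<close>
  have "?g x \<ge> 0"
  proof (rule tendsto_lowerbound)
    show "(?g \<longlongrightarrow> ?g x) (at x)"
      using isCont_sinhc by (auto intro!: tendsto_intros simp: isCont_def)
    show "\<forall>\<^sub>F y in at x. 0 \<le> ?g y"
      using * by (cases "x = 0") (auto simp: eventually_at_filter intro: eventually_mono [OF t1_space_nhds [of x 0]])
  qed simp
  then show ?thesis by simp
qed

lemma sinhc_pos: "sinhc 0 x > 0"
  by (cases "x = 0") (auto simp: sinhc_0 zero_less_divide_iff)

lemma sinhc_2_nonneg: "sinhc (Suc (Suc 0)) x \<ge> 0"
  using sinhc_log_convex [of x] sinhc_pos [of x]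
  by (smt (verit) zero_le_power2 zero_le_mult_iff)

section \<open>The Grauert density in the logarithmic coordinate\<close>

text \<open>\<open>S0\<close> is the S of the opening comment; \<open>S1\<close> and
  \<open>S2\<close> are its first two derivatives.\<close>

definition S0 :: "real \<Rightarrow> real" where "S0 x = 1 + (sinhc 0 x)\<^sup>2"

definition S1 :: "real \<Rightarrow> real" where "S1 x = 2 * sinhc 0 x * sinhc (Suc 0) x"

definition S2 :: "real \<Rightarrow> real" where "S2 x = 2 * ((sinhc (Suc 0) x)\<^sup>2 + sinhc 0 x * sinhc (Suc (Suc 0)) x)"

lemma DERIV_S0: "(S0 has_real_derivative S1 x) (at x)"
  unfolding S0_def [abs_def] S1_def by (auto intro!: derivative_eq_intros DERIV_sinhc)

lemma DERIV_S1: "(S1 has_real_derivative S2 x) (at x)"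
  unfolding S1_def [abs_def] S2_def by (auto intro!: derivative_eq_intros DERIV_sinhc simp: algebra_simps power2_eq_square)

lemma S0_pos: "S0 x > 0" by (simp add: S0_def add_pos_nonneg)

lemma S2_nonneg: "S2 x \<ge> 0"
  using sinhc_pos [of x] sinhc_2_nonneg [of x] by (simp add: S2_def)

text \<open>In S = 1 + r^2 the summand 1 contributes S'' and r^2 contributes its own log-convexity
  defect. Both parts are nonnegative, and the cancellation between S S'' and S'^2 is already carried
  out here, which also serves the asymptotics.\<close>

lemma S_log_convex_eq: "S0 x * S2 x - (S1 x)\<^sup>2 = S2 x + 2 * (sinhc 0 x)\<^sup>2 * (sinhc 0 x * sinhc (Suc (Suc 0)) x - (sinhc (Suc 0) x)\<^sup>2)"
  by (simp add: S0_def S1_def S2_def algebra_simps power2_eq_square)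

lemma S_log_convex: "(S1 x)\<^sup>2 \<le> S0 x * S2 x"
  using S_log_convex_eq [of x] S2_nonneg [of x] sinhc_log_convex [of x]
  by (smt (verit) zero_le_power2 zero_le_mult_iff)

text \<open>t u(t^2) = (t - 1/t) / (2 ln t) = sinh (ln t) / ln t; the removable points t = 1 and x =
  0 correspond.\<close>

lemma grauert_S0:
  assumes "t > 0" shows "1 + t\<^sup>2 * (grauert_u (t\<^sup>2))\<^sup>2 = S0 (ln t)"
proof (cases "t = 1")
  case False
  then have "ln t \<noteq> 0" "t\<^sup>2 \<noteq> 1" using assms by (auto simp: power2_eq_1_iff)
  moreover have "ln (t\<^sup>2) = 2 * ln t" using assms by (simp add: ln_realpow)
  ultimately show ?thesis using assms
    by (simp add: S0_def sinhc_0 sinh_ln_real grauert_u_def) (simp add: field_simps power2_eq_square)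
qed (simp add: S0_def grauert_u_def)

lemma phi_density_eq:
  assumes "f z \<noteq> 0"
  shows "phi_density f z = (cmod (deriv f z))\<^sup>2 * S0 (ln (cmod (f z))) + 1"
  using grauert_S0 [of "cmod (f z)"] assms by (simp add: phi_density_def)

section \<open>The curvature formula and its sign\<close>

text \<open>A factor |f'|^2 in a density multiplies the form h h_{z zbar} - h_z h_{zbar} by |f'|^4,
  which yields the first summand. Adding 1 to the density adds the mixed derivative of |f'|^2 S,
  which is the other three.\<close>

lemma gaussian_curvature_phi:
  fixes f :: "complex \<Rightarrow> complex"
  assumes f: "f holomorphic_on UNIV" and nz: "f z \<noteq> 0"
  defines "x \<equiv> ln (cmod (f z))" and "a \<equiv> deriv (deriv f) z" and "b \<equiv> (deriv f z)\<^sup>2 / (2 * f z)"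
  shows "gaussian_curvature (phi_density f) z = of_real
    (- 2 * ((cmod (deriv f z))\<^sup>2 * (cmod b)\<^sup>2 * (S0 x * S2 x - (S1 x)\<^sup>2)
       + (cmod a)\<^sup>2 * S0 x + 2 * Re (a * cnj b) * S1 x + (cmod b)\<^sup>2 * S2 x)
     / (phi_density f z) ^ 3)"
proof -
  define H where "H = (\<lambda>w. complex_of_real (phi_density f w))"
  define X where "X = (\<lambda>w. ln (cmod (f w)))"
  \<comment> \<open>The second derivative needs the formula for the first on a whole neighbourhood,
    hence an open set free of zeros.\<close>
  define U where "U = - (f -` {0})"
  define f1 where "f1 = deriv f"
  define f2 where "f2 = deriv f1"
  \<comment> \<open>The z-derivative of ln |f|.\<close>
  define l where "l = (\<lambda>w. f1 w / (2 * f w))"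
  have f1h: "f1 holomorphic_on UNIV" unfolding f1_def using f by (simp add: holomorphic_deriv)
  have f2h: "f2 holomorphic_on UNIV" unfolding f2_def using f1h by (simp add: holomorphic_deriv)
  have D: "(f has_field_derivative f1 w) (at w)" "(f1 has_field_derivative f2 w) (at w)"
    "(f2 has_field_derivative deriv f2 w) (at w)" for w
    using f f1h f2h by (auto simp: f1_def f2_def intro: holomorphic_derivI)
  have "continuous_on UNIV f" using f by (rule holomorphic_on_imp_continuous_on)
  then have U: "open U" "z \<in> U"
    using nz by (auto simp: U_def open_Compl closed_vimage)
  have UD: "f w \<noteq> 0" if "w \<in> U" for w using that by (auto simp: U_def)
  have Dl: "(l has_field_derivative f2 w / (2 * f w) - (f1 w)\<^sup>2 / (2 * (f w)\<^sup>2)) (at w)" if "w \<in> U" for w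
    unfolding l_def using UD [OF that] D [of w]
    by (auto intro!: derivative_eq_intros simp: field_simps power2_eq_square)
  have wS0: "has_wirtinger (\<lambda>w. of_real (S0 (X w))) (of_real (S1 (X w)) * l w) (of_real (S1 (X w)) * cnj (l w)) w"
    and wS1: "has_wirtinger (\<lambda>w. of_real (S1 (X w))) (of_real (S2 (X w)) * l w) (of_real (S2 (X w)) * cnj (l w)) w"
    if "w \<in> U" for w
    unfolding X_def l_def
    using has_wirtinger_ln_norm [OF DERIV_S0 D(1) UD [OF that]]
      has_wirtinger_ln_norm [OF DERIV_S1 D(1) UD [OF that]] by auto
  note w_hol = has_wirtinger_holomorphic [OF D(1)] has_wirtinger_holomorphic [OF D(2)]
    has_wirtinger_holomorphic [OF D(3)]
  have H_eq: "H w = f1 w * cnj (f1 w) * of_real (S0 (X w)) + 1" if "w \<in> U" for w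
    using phi_density_eq [of f w, OF UD [OF that]] unfolding H_def X_def f1_def
    by (simp add: complex_norm_square del: of_real_power)
  define G where "G = (\<lambda>w. f1 w * (cnj (f2 w) * of_real (S0 (X w)) + cnj (f1 w) * (of_real (S1 (X w)) * cnj (l w))))"
  have wH: "has_wirtinger H
      (cnj (f1 w) * (f2 w * of_real (S0 (X w)) + f1 w * (of_real (S1 (X w)) * l w))) (G w) w" if "w \<in> U" for w
  proof -
    have "has_wirtinger (\<lambda>w. f1 w * cnj (f1 w) * of_real (S0 (X w)) + 1)
      (cnj (f1 w) * (f2 w * of_real (S0 (X w)) + f1 w * (of_real (S1 (X w)) * l w))) (G w) w"
      using has_wirtinger_add [OF has_wirtinger_mult [OF has_wirtinger_mult
            [OF w_hol(2) has_wirtinger_cnj [OF w_hol(2)]] wS0 [OF that]] has_wirtinger_const [of 1]]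
      by (simp add: G_def algebra_simps)
    then show ?thesis by (rule has_wirtinger_transform [OF _ U(1) that]) (simp add: H_eq)
  qed
  \<comment> \<open>\<open>G\<close> is the zbar-derivative of \<open>H\<close> on \<open>U\<close>.
    The second coefficient is named through the operator itself, so that only the mixed derivative
    has to be written out.\<close>
  have wG: "has_wirtinger G
      (f2 z * (cnj (f2 z) * of_real (S0 (X z)) + cnj (f1 z) * (of_real (S1 (X z)) * cnj (l z)))
       + f1 z * (cnj (f2 z) * of_real (S1 (X z)) * l z + cnj (f1 z) * of_real (S2 (X z)) * l z * cnj (l z)))
      (wirtinger_bar G z) z"
  proof -
    obtain d where "has_wirtinger G
      (f2 z * (cnj (f2 z) * of_real (S0 (X z)) + cnj (f1 z) * (of_real (S1 (X z)) * cnj (l z)))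
       + f1 z * (cnj (f2 z) * of_real (S1 (X z)) * l z + cnj (f1 z) * of_real (S2 (X z)) * l z * cnj (l z))) d z"
      using has_wirtinger_mult [OF w_hol(2) has_wirtinger_add [OF has_wirtinger_mult [OF
          has_wirtinger_cnj [OF w_hol(3)] wS0 [OF U(2)]] has_wirtinger_mult [OF has_wirtinger_cnj [OF w_hol(2)]
          has_wirtinger_mult [OF wS1 [OF U(2)] has_wirtinger_cnj [OF has_wirtinger_holomorphic [OF Dl [OF U(2)]]]]]]]
      by (auto simp: G_def algebra_simps)
    then show ?thesis using has_wirtinger_imp by metis
  qed
  have "wirtinger_bar H w = G w" if "w \<in> U" for w
    using has_wirtinger_imp(2) [OF wH [OF that]] .
  then have "has_wirtinger (wirtinger_bar H)
      (f2 z * (cnj (f2 z) * of_real (S0 (X z)) + cnj (f1 z) * (of_real (S1 (X z)) * cnj (l z)))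
       + f1 z * (cnj (f2 z) * of_real (S1 (X z)) * l z + cnj (f1 z) * of_real (S2 (X z)) * l z * cnj (l z)))
      (wirtinger_bar G z) z"
    by (intro has_wirtinger_transform [OF wG U]) simp
  note W = has_wirtinger_imp(1) [OF this] has_wirtinger_imp [OF wH [OF U(2)]]
  have b: "b = f1 z * l z" by (simp add: b_def l_def f1_def power2_eq_square)
  have a: "a = f2 z" by (simp add: a_def f2_def f1_def)
  have re: "complex_of_real (2 * Re (a * cnj b)) = a * cnj b + cnj a * b"
    using complex_add_cnj [of "a * cnj b"] by (simp add: mult.commute)
  have "gaussian_curvature (phi_density f) z = - 2 / H z ^ 3 *
      (H z * wirtinger (wirtinger_bar H) z - wirtinger H z * wirtinger_bar H z)"
    by (simp add: gaussian_curvature_def Let_def H_def)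
  also have "H z * wirtinger (wirtinger_bar H) z - wirtinger H z * wirtinger_bar H z =
     of_real ((cmod (deriv f z))\<^sup>2 * (cmod b)\<^sup>2 * (S0 x * S2 x - (S1 x)\<^sup>2)
       + (cmod a)\<^sup>2 * S0 x + 2 * Re (a * cnj b) * S1 x + (cmod b)\<^sup>2 * S2 x)"
    unfolding W H_eq [OF U(2)] G_def of_real_add [of "_ + _"] of_real_mult [of "2 * Re (a * cnj b)"] re
    by (simp add: complex_norm_square a b x_def flip: X_def f1_def of_real_power)
       (simp add: X_def algebra_simps power2_eq_square)
  finally show ?thesis
    by (simp only: H_def times_divide_eq_left of_real_divide of_real_power of_real_mult
        of_real_minus of_real_neg_numeral of_real_numeral)
qed

text \<open>Complete the square after multiplying by \<open>A\<close>.\<close>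

lemma quadratic_form_nonneg:
  fixes a b :: complex and A B C :: real
  assumes "A > 0" "B\<^sup>2 \<le> A * C"
  shows "(cmod a)\<^sup>2 * A + 2 * Re (a * cnj b) * B + (cmod b)\<^sup>2 * C \<ge> 0"
proof -
  have "A * ((cmod a)\<^sup>2 * A + 2 * Re (a * cnj b) * B + (cmod b)\<^sup>2 * C) =
      (cmod (of_real A * a + of_real B * b))\<^sup>2 + (cmod b)\<^sup>2 * (A * C - B\<^sup>2)"
    unfolding cmod_power2 by (simp add: algebra_simps power2_eq_square)
  also have "\<dots> \<ge> 0" using assms by simp
  finally show ?thesis using assms by (simp add: zero_le_mult_iff)
qed

lemma phi_density_pos: "phi_density f z > 0"
  by (simp add: phi_density_def add_nonneg_pos)

lemma curvature_nonpos:
  assumes f: "f holomorphic_on UNIV" and nz: "f z \<noteq> 0"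
  shows "gaussian_curvature (phi_density f) z \<in> \<real>\<^sub>\<le>\<^sub>0"
proof -
  define x where "x = ln (cmod (f z))"
  define a where "a = deriv (deriv f) z"
  define b where "b = (deriv f z)\<^sup>2 / (2 * f z)"
  have "0 \<le> (cmod (deriv f z))\<^sup>2 * (cmod b)\<^sup>2 * (S0 x * S2 x - (S1 x)\<^sup>2)
       + (cmod a)\<^sup>2 * S0 x + 2 * Re (a * cnj b) * S1 x + (cmod b)\<^sup>2 * S2 x"
    \<comment> \<open>Log-convexity enters twice: for the first summand, and as the discriminant
      condition on the quadratic form in \<open>a\<close> and \<open>b\<close> made of the other
      three.\<close>
    unfolding add.assoc
    by (rule add_nonneg_nonneg [OF _ quadratic_form_nonneg [OF S0_pos S_log_convex, unfolded add.assoc]])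
       (simp add: S_log_convex)
  then show ?thesis
    unfolding gaussian_curvature_phi [OF assms] nonpos_Reals_of_real_iff
    using phi_density_pos [of f z] by (simp add: a_def b_def x_def divide_nonpos_pos)
qed

text \<open>With f' = 0 also b = 0, and only the term |f''|^2 S with S > 0 survives.\<close>

lemma curvature_eq_0_iff:
  assumes f: "f holomorphic_on UNIV" and nz: "f z \<noteq> 0" and "deriv f z = 0"
  shows "gaussian_curvature (phi_density f) z = 0 \<longleftrightarrow> deriv (deriv f) z = 0"
  unfolding gaussian_curvature_phi [OF f nz]
  using S0_pos [of "ln (cmod (f z))"] phi_density_pos [of f z] assms(3) by simp

section \<open>The limit of the curvature at the zeros of f\<close>

text \<open>At -\<infinity>, S is asymptotic to exp (-2x) / (4 x^2) and S S'' - S'^2 to exp (-4x) /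
  (8 x^6); the constants follow from these.\<close>

lemma S_at_bot:
  "((\<lambda>x. (S0 x * S2 x - (S1 x)\<^sup>2) / (4 * exp (2 * x) * S0 x ^ 3)) \<longlongrightarrow> 2) at_bot" (is ?A)
  "((\<lambda>x. exp (2 * x) * x\<^sup>2 * S0 x) \<longlongrightarrow> 1 / 4) at_bot" (is ?B)
  "((\<lambda>x. S1 x / S0 x) \<longlongrightarrow> -2) at_bot" (is ?C)
  "((\<lambda>x. S2 x / S0 x) \<longlongrightarrow> 4) at_bot" (is ?D)
proof -
  let ?r0 = "\<lambda>x::real. sinh x / x" and ?r1 = "\<lambda>x::real. cosh x / x - sinh x / x\<^sup>2"
    and ?r2 = "\<lambda>x::real. sinh x / x - 2 * cosh x / x\<^sup>2 + 2 * sinh x / x ^ 3"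
  have "eventually (\<lambda>x::real. x < 0) at_bot" by (simp add: eventually_at_bot_dense)
  \<comment> \<open>The fourth identity replaces S S'' - S'^2 by its form after cancellation, before
    the asymptotics are computed.\<close>
  then have ev: "\<forall>\<^sub>F x in at_bot. 1 + (?r0 x)\<^sup>2 = S0 x \<and> 2 * ?r0 x * ?r1 x = S1 x
      \<and> 2 * ((?r1 x)\<^sup>2 + ?r0 x * ?r2 x) = S2 x
      \<and> 2 * ((?r1 x)\<^sup>2 + ?r0 x * ?r2 x) + 2 * (?r0 x)\<^sup>2 * (((sinh x)\<^sup>2 - x\<^sup>2) / x ^ 4) = S0 x * S2 x - (S1 x)\<^sup>2"
  proof eventually_elim
    case (elim x)
    then have "x \<noteq> 0" by simp
    then show ?case unfolding S_log_convex_eq sinhc_log_convex_eq [OF \<open>x \<noteq> 0\<close>]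
      by (simp add: S0_def S1_def S2_def sinhc_0 sinhc_1 sinhc_2)
  qed
  have "((\<lambda>x. (2 * ((?r1 x)\<^sup>2 + ?r0 x * ?r2 x) + 2 * (?r0 x)\<^sup>2 * (((sinh x)\<^sup>2 - x\<^sup>2) / x ^ 4)) /
      (4 * exp (2 * x) * (1 + (?r0 x)\<^sup>2) ^ 3)) \<longlongrightarrow> 2) at_bot"
    unfolding sinh_field_def cosh_field_def by real_asymp (simp add: power_divide)
  then show ?A by (rule Lim_transform_eventually) (use ev in eventually_elim, elim conjE, simp only:)
  have "((\<lambda>x. exp (2 * x) * x\<^sup>2 * (1 + (?r0 x)\<^sup>2)) \<longlongrightarrow> 1 / 4) at_bot"
    unfolding sinh_field_def by real_asymp (simp add: power_divide)
  then show ?B by (rule Lim_transform_eventually) (use ev in eventually_elim, elim conjE, simp only:)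
  have "((\<lambda>x. 2 * ?r0 x * ?r1 x / (1 + (?r0 x)\<^sup>2)) \<longlongrightarrow> -2) at_bot"
    unfolding sinh_field_def cosh_field_def by real_asymp (simp add: power_divide)
  then show ?C by (rule Lim_transform_eventually) (use ev in eventually_elim, elim conjE, simp only:)
  have "((\<lambda>x. 2 * ((?r1 x)\<^sup>2 + ?r0 x * ?r2 x) / (1 + (?r0 x)\<^sup>2)) \<longlongrightarrow> 4) at_bot"
    unfolding sinh_field_def cosh_field_def by real_asymp (simp add: power_divide)
  then show ?D by (rule Lim_transform_eventually) (use ev in eventually_elim, elim conjE, simp only:)
qed

text \<open>Numerator and denominator are divided by (D S)^3. Here F = |f|^2, D = |f'|^2,
  \<open>L\<close> stands for S S'' - S'^2, \<open>T\<close> and \<open>R\<close> for S' and S'',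
  \<open>c2\<close> and \<open>rc\<close> for |c|^2 and Re c. Powers of \<open>x\<close> are
  inserted so that F / D = |q|^2 and F = exp (2x) occur only in combinations with a limit.\<close>

lemma curvature_quotient_identity:
  fixes F D S x :: real
  assumes "F > 0" "D > 0" "S > 0" "x \<noteq> 0"
  shows "(D * (D\<^sup>2 / (4 * F)) * L + c2 * D\<^sup>2 / F * S + 2 * (rc * D\<^sup>2 / (2 * F)) * T + D\<^sup>2 / (4 * F) * R) / (D * S + 1) ^ 3
    = (L / (4 * F * S ^ 3) + (F / D * x ^ 4) / (4 * (F * x\<^sup>2 * S)\<^sup>2) * (4 * c2 + 4 * rc * (T / S) + R / S))
      / (1 + (F / D * x\<^sup>2) / (F * x\<^sup>2 * S)) ^ 3"
proof -
  have e: "1 + (F / D * x\<^sup>2) / (F * x\<^sup>2 * S) = (D * S + 1) / (D * S)"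
    using assms by (simp add: field_simps)
  have "D * S + 1 > 0" using assms by (simp add: add_pos_pos)
  then show ?thesis unfolding e using assms
    by (simp add: divide_simps) (simp add: algebra_simps eval_nat_numeral)
qed

lemma curvature_split:
  fixes f :: "complex \<Rightarrow> complex"
  assumes f: "f holomorphic_on UNIV" and nz: "f z \<noteq> 0" "deriv f z \<noteq> 0" and "ln (cmod (f z)) \<noteq> 0"
  defines "x \<equiv> ln (cmod (f z))" and "q \<equiv> f z / deriv f z"
    and "c \<equiv> f z * deriv (deriv f) z / (deriv f z)\<^sup>2"
  shows "gaussian_curvature (phi_density f) z = of_real
    (- 2 * (((S0 x * S2 x - (S1 x)\<^sup>2) / (4 * exp (2 * x) * S0 x ^ 3)
        + (cmod q * x\<^sup>2)\<^sup>2 / (4 * (exp (2 * x) * x\<^sup>2 * S0 x)\<^sup>2)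
          * (4 * (cmod c)\<^sup>2 + 4 * Re c * (S1 x / S0 x) + S2 x / S0 x))
      / (1 + (cmod q * x)\<^sup>2 / (exp (2 * x) * x\<^sup>2 * S0 x)) ^ 3))"
proof -
  define F where "F = (cmod (f z))\<^sup>2"
  define D where "D = (cmod (deriv f z))\<^sup>2"
  define b where "b = (deriv f z)\<^sup>2 / (2 * f z)"
  have E: "exp (2 * x) = F" using nz by (simp add: x_def F_def exp_double)
  have pos: "F > 0" "D > 0" "x \<noteq> 0" using assms by (auto simp: F_def D_def)
  have q: "(cmod q * x)\<^sup>2 = F / D * x\<^sup>2" "(cmod q * x\<^sup>2)\<^sup>2 = F / D * x ^ 4"
    by (simp_all add: q_def F_def D_def norm_divide power_divide power_mult_distrib)
  have b: "(cmod b)\<^sup>2 = D\<^sup>2 / (4 * F)"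
    by (simp add: b_def F_def D_def norm_divide norm_mult norm_power power_divide power_mult_distrib)
  have a2: "deriv (deriv f) z = 2 * c * b" using nz by (simp add: b_def c_def field_simps power2_eq_square)
  have a: "(cmod (deriv (deriv f) z))\<^sup>2 = (cmod c)\<^sup>2 * D\<^sup>2 / F"
    unfolding a2 using pos by (simp add: norm_mult power_mult_distrib b field_simps)
  have "deriv (deriv f) z * cnj b = of_real (2 * (cmod b)\<^sup>2) * c"
    unfolding a2 by (simp add: complex_norm_square del: of_real_power)
  then have ab: "Re (deriv (deriv f) z * cnj b) = Re c * D\<^sup>2 / (2 * F)"
    using pos by (simp only: b) (simp add: field_simps)
  note aux = curvature_quotient_identity [OF pos(1,2) S0_pos [of x] pos(3)]
  show ?thesis
    unfolding gaussian_curvature_phi [OF f nz(1)] phi_density_eq [of f z, OF nz(1)] E q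
    unfolding b_def [symmetric] x_def [symmetric] D_def [symmetric] b a ab
      times_divide_eq_right [of "- 2", symmetric] aux ..
qed

text \<open>Write f = (z - p)^n g with g nonvanishing near p. Then q equals z - p times a
  holomorphic function, and |z - p| outweighs any power of ln |z - p|.\<close>

lemma zero_asymptotics:
  fixes f :: "complex \<Rightarrow> complex"
  assumes f: "f holomorphic_on UNIV" and nc: "\<not> f constant_on UNIV" and fp: "f p = 0"
  shows "\<forall>\<^sub>F z in at p. f z \<noteq> 0 \<and> deriv f z \<noteq> 0"
    and "filterlim (\<lambda>z. ln (cmod (f z))) at_bot (at p)"
    and "((\<lambda>z. cmod (f z / deriv f z) * (ln (cmod (f z)))\<^sup>2) \<longlongrightarrow> 0) (at p)"
    and "((\<lambda>z. cmod (f z / deriv f z) * ln (cmod (f z))) \<longlongrightarrow> 0) (at p)"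
    and "\<exists>c. ((\<lambda>z. f z * deriv (deriv f) z / (deriv f z)\<^sup>2) \<longlongrightarrow> c) (at p)"
proof -
  obtain g r n where n: "0 < n" and r: "0 < r" and g: "g holomorphic_on ball p r"
    and feq: "\<And>w. w \<in> ball p r \<Longrightarrow> f w = (w - p) ^ n * g w"
    and gnz: "\<And>w. w \<in> ball p r \<Longrightarrow> g w \<noteq> 0"
    using holomorphic_factor_zero_nonconstant [OF f open_UNIV connected_UNIV UNIV_I fp nc] by metis
  \<comment> \<open>The cofactor left in f' after extracting (z - p)^(n-1); m(p) = n g(p) is
    nonzero.\<close>
  define m where "m = (\<lambda>z. of_nat n * g z + (z - p) * deriv g z)"
  have m: "m holomorphic_on ball p r"
    unfolding m_def using g by (intro holomorphic_intros holomorphic_deriv) auto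
  have "isCont m p" using m r
    by (metis centre_in_ball continuous_on_eq_continuous_at holomorphic_on_imp_continuous_on open_ball)
  moreover have "m p \<noteq> 0" using n r gnz [of p] by (simp add: m_def)
  ultimately obtain s where s: "s > 0" "\<And>z. z \<in> ball p s \<Longrightarrow> m z \<noteq> 0"
    using continuous_at_avoid by (metis mem_ball)
  define B where "B = ball p (min r s)"
  have B: "open B" "p \<in> B" "B \<subseteq> ball p r" "\<And>z. z \<in> B \<Longrightarrow> m z \<noteq> 0"
    using r s by (auto simp: B_def)
  have ev: "\<forall>\<^sub>F z in at p. z \<in> B - {p}"
    using B by (auto simp: eventually_at_filter intro: eventually_mono [OF eventually_nhds_in_open [OF B(1,2)]])
  have df: "deriv f z = (z - p) ^ (n - 1) * m z" if "z \<in> B" for z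
  proof (rule DERIV_imp_deriv)
    have zr: "z \<in> ball p r" using that B by auto
    have "((\<lambda>w. (w - p) ^ n * g w) has_field_derivative
        of_nat n * (z - p) ^ (n - 1) * g z + deriv g z * (z - p) ^ n) (at z)"
      by (auto intro!: derivative_eq_intros holomorphic_derivI [OF g _ zr])
    also have "of_nat n * (z - p) ^ (n - 1) * g z + deriv g z * (z - p) ^ n = (z - p) ^ (n - 1) * m z"
      using n by (cases n) (simp_all add: m_def algebra_simps del: of_nat_Suc)
    finally have "((\<lambda>w. (w - p) ^ n * g w) has_field_derivative (z - p) ^ (n - 1) * m z) (at z)" .
    then show "(f has_field_derivative (z - p) ^ (n - 1) * m z) (at z)"
      by (rule has_field_derivative_transform_within_open [OF _ open_ball zr]) (simp add: feq)
  qed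
  define k where "k = (\<lambda>z. g z / m z)"
  have k: "k holomorphic_on B" unfolding k_def
    using B g m by (intro holomorphic_intros) (auto intro: holomorphic_on_subset)
  define Q where "Q = (\<lambda>z. (z - p) * k z)"
  have Q: "Q holomorphic_on B" unfolding Q_def using k by (intro holomorphic_intros)
  have fnz: "f z \<noteq> 0 \<and> deriv f z \<noteq> 0" if "z \<in> B - {p}" for z
    using that feq [of z] df [of z] gnz [of z] B by auto
  have q: "f z / deriv f z = Q z" if "z \<in> B - {p}" for z
    using that feq [of z] df [of z] gnz [of z] B n by (cases n) (auto simp: Q_def k_def)
  show fnz': "\<forall>\<^sub>F z in at p. f z \<noteq> 0 \<and> deriv f z \<noteq> 0"
    using ev by eventually_elim (rule fnz)
  have "(f \<longlongrightarrow> 0) (at p)"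
    using f fp by (metis UNIV_I continuous_on_def holomorphic_on_imp_continuous_on)
  then have "filterlim (\<lambda>z. cmod (f z)) (at_right 0) (at p)"
    using fnz' by (auto simp: filterlim_at tendsto_norm_zero elim: eventually_mono)
  with ln_at_0 show "filterlim (\<lambda>z. ln (cmod (f z))) at_bot (at p)"
    by (rule filterlim_compose)
  have \<rho>: "filterlim (\<lambda>z. cmod (z - p)) (at_right 0) (at p)"
    by (auto simp: filterlim_at eventually_at_filter intro!: tendsto_eq_intros)
  have \<rho>0: "((\<lambda>z. cmod (z - p)) \<longlongrightarrow> 0) (at p)"
    using \<rho> by (simp add: filterlim_at)
  have "((\<lambda>t::real. t * ln t) \<longlongrightarrow> 0) (at_right 0)" by real_asymp
  from filterlim_compose [OF this \<rho>] have \<rho>1: "((\<lambda>z. cmod (z - p) * ln (cmod (z - p))) \<longlongrightarrow> 0) (at p)" .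
  have "((\<lambda>t::real. t * (ln t)\<^sup>2) \<longlongrightarrow> 0) (at_right 0)" by real_asymp
  from filterlim_compose [OF this \<rho>] have \<rho>2: "((\<lambda>z. cmod (z - p) * (ln (cmod (z - p)))\<^sup>2) \<longlongrightarrow> 0) (at p)" .
  have "(k \<longlongrightarrow> k p) (at p)"
    using k B by (metis continuous_on_eq_continuous_at holomorphic_on_imp_continuous_on isCont_def)
  then have kl: "((\<lambda>z. cmod (k z)) \<longlongrightarrow> cmod (k p)) (at p)" by (rule tendsto_norm)
  have "(g \<longlongrightarrow> g p) (at p)"
    using g r by (metis centre_in_ball open_ball continuous_on_eq_continuous_at holomorphic_on_imp_continuous_on isCont_def)
  then have gl: "((\<lambda>z. ln (cmod (g z))) \<longlongrightarrow> ln (cmod (g p))) (at p)"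
    using gnz [of p] r by (auto intro!: tendsto_intros)
  have lnf: "ln (cmod (f z)) = n * ln (cmod (z - p)) + ln (cmod (g z))" if "z \<in> B - {p}" for z
    using that feq [of z] gnz [of z] B by (auto simp: norm_mult norm_power ln_mult ln_realpow)
  have "((\<lambda>z. cmod (k z) * (n * (cmod (z - p) * ln (cmod (z - p))) + cmod (z - p) * ln (cmod (g z)))) \<longlongrightarrow>
      cmod (k p) * (real n * 0 + 0 * ln (cmod (g p)))) (at p)"
    by (intro tendsto_mult tendsto_add tendsto_const kl gl \<rho>0 \<rho>1)
  then have "((\<lambda>z. cmod (k z) * (n * (cmod (z - p) * ln (cmod (z - p))) + cmod (z - p) * ln (cmod (g z)))) \<longlongrightarrow> 0) (at p)"
    by simp
  then show "((\<lambda>z. cmod (f z / deriv f z) * ln (cmod (f z))) \<longlongrightarrow> 0) (at p)"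
    by (rule Lim_transform_eventually)
       (use ev in eventually_elim, simp only: q lnf Q_def norm_mult, simp add: algebra_simps)
  \<comment> \<open>The square of n ln |z - p| + ln |g| is expanded so that each summand has its own
    factor tending to 0.\<close>
  have "((\<lambda>z. cmod (k z) * ((real n)\<^sup>2 * (cmod (z - p) * (ln (cmod (z - p)))\<^sup>2)
        + 2 * real n * (cmod (z - p) * ln (cmod (z - p))) * ln (cmod (g z))
        + cmod (z - p) * (ln (cmod (g z)))\<^sup>2)) \<longlongrightarrow>
      cmod (k p) * ((real n)\<^sup>2 * 0 + 2 * real n * 0 * ln (cmod (g p)) + 0 * (ln (cmod (g p)))\<^sup>2)) (at p)"
    by (intro tendsto_mult tendsto_add tendsto_const tendsto_power kl gl \<rho>0 \<rho>1 \<rho>2)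
  then have "((\<lambda>z. cmod (k z) * ((real n)\<^sup>2 * (cmod (z - p) * (ln (cmod (z - p)))\<^sup>2)
        + 2 * real n * (cmod (z - p) * ln (cmod (z - p))) * ln (cmod (g z))
        + cmod (z - p) * (ln (cmod (g z)))\<^sup>2)) \<longlongrightarrow> 0) (at p)"
    by simp
  then show "((\<lambda>z. cmod (f z / deriv f z) * (ln (cmod (f z)))\<^sup>2) \<longlongrightarrow> 0) (at p)"
    by (rule Lim_transform_eventually)
       (use ev in eventually_elim, simp only: q lnf Q_def norm_mult, simp add: algebra_simps power2_eq_square)
  have f1: "deriv f holomorphic_on UNIV" using f by (simp add: holomorphic_deriv)
  \<comment> \<open>By the quotient rule q' = 1 - c off p. Since \<open>Q\<close> extends q
    holomorphically over p, \<open>deriv Q\<close> is continuous there and c converges.\<close>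
  have c: "1 - deriv Q z = f z * deriv (deriv f) z / (deriv f z)\<^sup>2" if "z \<in> B - {p}" for z
  proof -
    have "((\<lambda>w. f w / deriv f w) has_field_derivative 1 - f z * deriv (deriv f) z / (deriv f z)\<^sup>2) (at z)"
      using fnz [OF that] by (auto intro!: derivative_eq_intros holomorphic_derivI [OF f] holomorphic_derivI [OF f1]
          simp: field_simps power2_eq_square)
    then have "(Q has_field_derivative 1 - f z * deriv (deriv f) z / (deriv f z)\<^sup>2) (at z)"
      by (rule has_field_derivative_transform_within_open [of _ _ _ "B - {p}"]) (use B that q in auto)
    then show ?thesis by (simp add: DERIV_imp_deriv)
  qed
  have "deriv Q holomorphic_on B" using Q B by (simp add: holomorphic_deriv)
  then have "(deriv Q \<longlongrightarrow> deriv Q p) (at p)"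
    using B by (metis continuous_on_eq_continuous_at holomorphic_on_imp_continuous_on isCont_def)
  then have "((\<lambda>z. 1 - deriv Q z) \<longlongrightarrow> 1 - deriv Q p) (at p)" by (intro tendsto_intros)
  then have "((\<lambda>z. f z * deriv (deriv f) z / (deriv f z)\<^sup>2) \<longlongrightarrow> 1 - deriv Q p) (at p)"
    by (rule Lim_transform_eventually) (use ev in eventually_elim, rule c)
  then show "\<exists>c. ((\<lambda>z. f z * deriv (deriv f) z / (deriv f z)\<^sup>2) \<longlongrightarrow> c) (at p)" ..
qed

lemma curvature_tendsto:
  fixes f :: "complex \<Rightarrow> complex"
  assumes f: "f holomorphic_on UNIV" and nc: "\<not> f constant_on UNIV" and fp: "f p = 0"
  shows "(gaussian_curvature (phi_density f) \<longlongrightarrow> -4) (at p)"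
proof -
  note A = zero_asymptotics [OF assms]
  define x where "x = (\<lambda>z. ln (cmod (f z)))"
  define q where "q = (\<lambda>z. f z / deriv f z)"
  define c where "c = (\<lambda>z. f z * deriv (deriv f) z / (deriv f z)\<^sup>2)"
  obtain c0 where c: "(c \<longlongrightarrow> c0) (at p)" using A(5) by (auto simp: c_def)
  have x: "filterlim x at_bot (at p)" using A(2) by (simp add: x_def)
  note S = S_at_bot [THEN filterlim_compose, OF x]
  have q: "((\<lambda>z. cmod (q z) * (x z)\<^sup>2) \<longlongrightarrow> 0) (at p)" "((\<lambda>z. cmod (q z) * x z) \<longlongrightarrow> 0) (at p)"
    using A(3,4) by (simp_all add: q_def x_def)
  \<comment> \<open>Secures ln |f| \<noteq> 0, as \<open>curvature_split\<close> requires.\<close>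
  have "\<forall>\<^sub>F z in at p. x z < 0"
    using x by (simp add: filterlim_at_bot_dense)
  with A(1) have ev: "\<forall>\<^sub>F z in at p. of_real
    (- 2 * (((S0 (x z) * S2 (x z) - (S1 (x z))\<^sup>2) / (4 * exp (2 * x z) * S0 (x z) ^ 3)
        + (cmod (q z) * (x z)\<^sup>2)\<^sup>2 / (4 * (exp (2 * x z) * (x z)\<^sup>2 * S0 (x z))\<^sup>2)
          * (4 * (cmod (c z))\<^sup>2 + 4 * Re (c z) * (S1 (x z) / S0 (x z)) + S2 (x z) / S0 (x z)))
      / (1 + (cmod (q z) * x z)\<^sup>2 / (exp (2 * x z) * (x z)\<^sup>2 * S0 (x z))) ^ 3)) =
      gaussian_curvature (phi_density f) z" (is "\<forall>\<^sub>F z in at p. of_real (?K z) = _")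
  proof eventually_elim
    case (elim z)
    then have "f z \<noteq> 0" "deriv f z \<noteq> 0" "ln (cmod (f z)) \<noteq> 0" by (auto simp: x_def)
    from curvature_split [OF f this] show ?case unfolding x_def q_def c_def by (rule sym)
  qed
  \<comment> \<open>The terms with q vanish because their denominators tend to nonzero constants and
    c stays bounded; what remains is -2 * 2.\<close>
  have "(?K \<longlongrightarrow> - 2 * ((2 + 0\<^sup>2 / (4 * (1 / 4)\<^sup>2) * (4 * (cmod c0)\<^sup>2 + 4 * Re c0 * (-2) + 4))
      / (1 + 0\<^sup>2 / (1 / 4)) ^ 3)) (at p)"
    by (intro tendsto_intros S q c) simp_all
  then have "(?K \<longlongrightarrow> - 4) (at p)" by simp
  then have "((\<lambda>z. complex_of_real (?K z)) \<longlongrightarrow> of_real (- 4)) (at p)" by (rule tendsto_of_real)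
  then show ?thesis using ev by (simp add: Lim_transform_eventually)
qed

theorem theorem5p1:
  fixes f :: "complex \<Rightarrow> complex" and K :: "complex \<Rightarrow> complex" and p :: complex
  assumes "f holomorphic_on UNIV"
    and "\<not> f constant_on UNIV"
  defines "K \<equiv> gaussian_curvature (phi_density f)"
  shows "(f p \<noteq> 0 \<longrightarrow>
            K p \<in> \<real>\<^sub>\<le>\<^sub>0 \<and> (deriv f p = 0 \<longrightarrow> (K p = 0 \<longleftrightarrow> deriv (deriv f) p = 0))) \<and>
         (f p = 0 \<longrightarrow> (K \<longlongrightarrow> -4) (at p))"
  unfolding K_def using assms curvature_nonpos curvature_eq_0_iff curvature_tendsto by blast

end
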